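(* Let $f:\mathbb{R}^n\to\mathbb{R}$ be a real polynomial of degree $d$ with zero constant term, $f(x)=\sum_{0<|\alpha|\le d} b_\alpha x^\alpha$ (with $b_\alpha:=0$ for $|\alpha|>d$), and let $g_1,\dots,g_r:\mathbb{R}^n\to\mathbb{R}$ be real polynomials, $g_i$ of degree $w_i$; put $\tilde w_i=\lceil w_i/2\rceil$. Let $N$ be a positive integer with $2N\ge d$ and $2N\ge\max_i w_i$, and assume that there are positive integers $m_0,l_0,m_i,l_i$ ($i=1,\dots,r$) such that $s(N)=m_0l_0$ and $s(N-\tilde w_i)=m_il_i$ for $i=1,\dots,r$, where $s(k)=\binom{n+k}{k}$. With the tensors $\mathcal{X}_0,\mathcal{X}_i,\mathcal{A}_\alpha,\mathcal{D}_{i\alpha}$ defined in the context, consider the T-semidefinite program $(\mathbb{Q}_N^{l_0,l_1,\dots,l_r})$: $$\max\; -\langle \mathcal{Z}_0,\mathcal{A}_0\rangle-\sum_{i=1}^r\langle\mathcal{Z}_i,\mathcal{D}_{i0}\rangle$$ subject to $$\langle\mathcal{Z}_0,\mathcal{A}_\alpha\rangle+\sum_{i=1}^r\langle\mathcal{Z}_i,\mathcal{D}_{i\alpha}\rangle=b_\alpha\ \ (0<|\alpha|\le 2N),\qquad \mathcal{Z}_0\in\mathbb{S}_+^{m_0\times m_0\times l_0},\ \ \mathcal{Z}_i\in\mathbb{S}_+^{m_i\times m_i\times l_i}\ (i=1,\dots,r).$$ Then $(\mathbb{Q}_N^{l_0,l_1,\dots,l_r})$ has a feasible solution if and only if there exist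 $\gamma\in\mathbb{R}$ and third-order tensors $\mathcal{Z}_0\in\mathbb{S}_+^{m_0\times m_0\times l_0}$, $\mathcal{Z}_i\in\mathbb{S}_+^{m_i\times m_i\times l_i}$, $i=1,\dots,r$, such that (as polynomials in $x$) $$f(x)-\gamma=\left\langle\mathcal{Z}_0,\mathcal{X}_0*\mathcal{X}_0^{\mathsf T}\right\rangle+\sum_{i=1}^r g_i(x)\left\langle\mathcal{Z}_i,\mathcal{X}_i*\mathcal{X}_i^{\mathsf T}\right\rangle.$$
   Context: Third-order tensors. A tensor $\mathcal{A}\in\mathbb{R}^{m\times n\times l}$ is viewed as a stack of frontal slices $A^{(1)},\dots,A^{(l)}\in\mathbb{R}^{m\times n}$. $\mathrm{bcirc}(\mathcal{A})\in\mathbb{R}^{ml\times nl}$ is the block circulant matrix whose $(p,q)$ block is $A^{(((p-q)\bmod l)+1)}$, $1\le p,q\le l$ (first block column $A^{(1)},A^{(2)},\dots,A^{(l)}$). $\mathrm{unfold}(\mathcal{A})\in\mathbb{R}^{ml\times n}$ stacks $A^{(1)},\dots,A^{(l)}$ vertically, and $\mathrm{fold}_l$ is its inverse. The product of $\mathcal{A}\in\mathbb{R}^{m\times n\times l}$ and $\mathcal{B}\in\mathbb{R}^{n\times p\times l}$ is $\mathcal{A}*\mathcal{B}:=\mathrm{fold}_l(\mathrm{bcirc}(\mathcal{A})\,\mathrm{unfold}(\mathcal{B}))\in\mathbb{R}^{m\times p\times l}$. The transpose $\mathcal{A}^{\mathsf T}$ is obtained by transposing each frontal slice and then reversing the order of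 the transposed slices $2$ through $l$. The inner product $\langle\mathcal{A},\mathcal{B}\rangle$ is the sum of products of corresponding entries. $\mathbb{S}^{m\times m\times l}$ is the set of symmetric tensors ($\mathcal{A}^{\mathsf T}=\mathcal{A}$) in $\mathbb{R}^{m\times m\times l}$, and $\mathbb{S}_+^{m\times m\times l}$ is the set of positive semidefinite tensors, i.e. those $\mathcal{A}\in\mathbb{S}^{m\times m\times l}$ with $\langle\mathcal{X},\mathcal{A}*\mathcal{X}\rangle\ge0$ for all $\mathcal{X}\in\mathbb{R}^{m\times1\times l}$. Monomials. For $\alpha\in\mathbb{N}^n$ (nonnegative integers), $x^\alpha=x_1^{\alpha_1}\cdots x_n^{\alpha_n}$ and $|\alpha|=\sum_i\alpha_i$. $[x]_k:=[1,x_1,\dots,x_n,x_1^2,x_1x_2,\dots,x_n^2,\dots,x_1^k,\dots,x_n^k]^{\mathsf T}$ is the vector of all monomials of degree at most $k$, of length $s(k)=\binom{n+k}{k}$. Data of the relaxation. $\mathcal{X}_0:=\mathrm{fold}_{l_0}([x]_N)$ (of size $m_0\times1\times l_0$), $\mathcal{X}_i:=\mathrm{fold}_{l_i}([x]_{N-\tilde w_i})$ (of size $m_i\times1\times l_i$). The real constant tensors $\mathcal{A}_\alpha\in\mathbb{R}^{m_0\times m_0\times l_0}$ and $\mathcal{D}_{i\alpha}\in\mathbb{R}^{m_i\times m_i\times l_i}$ are determined by $\mathcal{X}_0*\mathcal{X}_0^{\mathsf T}=\sum_{0\le|\alpha|\le2N}\mathcal{A}_\alpha x^\alpha$ and $g_i(x)\,\mathcal{X}_i*\mathcal{X}_i^{\mathsf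 T}=\sum_{0\le|\alpha|\le2N}\mathcal{D}_{i\alpha}x^\alpha$, $i=1,\dots,r$; the subscript $0$ in $\mathcal{A}_0,\mathcal{D}_{i0}$ denotes $\alpha=0$. *)

theory Defs
  imports "HOL-Library.Poly_Mapping" "Jordan_Normal_Form.Matrix"
begin

section \<open>Third-order tensors\<close>

text \<open>A tensor is the list of its frontal slices. The row and column dimensions are read off the
  first slice, so they are meaningful only for tensors with at least one slice.\<close>

type_synonym 'a tensor = "'a mat list"

definition tensors :: "nat \<Rightarrow> nat \<Rightarrow> nat \<Rightarrow> 'a tensor set" where
  "tensors m n l = {A. length A = l \<and> set A \<subseteq> carrier_mat m n}"

definition trows :: "'a tensor \<Rightarrow> nat" where
  "trows A = dim_row (hd A)"

definition tcols :: "'a tensor \<Rightarrow> nat" where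
  "tcols A = dim_col (hd A)"

text \<open>Rows, columns, slices and blocks are indexed from 0; the difference of block indices is taken
  in the integers because it may be negative.\<close>

definition bcirc :: "'a tensor \<Rightarrow> 'a mat" where
  "bcirc A = (let m = trows A; n = tcols A; l = length A in
     mat (m * l) (n * l) (\<lambda>(i, j).
       (A ! nat ((int (i div m) - int (j div n)) mod int l)) $$ (i mod m, j mod n)))"

definition tunfold :: "'a tensor \<Rightarrow> 'a mat" where
  "tunfold A = (let m = trows A in
     mat (m * length A) (tcols A) (\<lambda>(i, j). (A ! (i div m)) $$ (i mod m, j)))"

definition tfold :: "nat \<Rightarrow> 'a mat \<Rightarrow> 'a tensor" where
  "tfold l M = (let m = dim_row M div l in
     map (\<lambda>k. mat m (dim_col M) (\<lambda>(i, j). M $$ (k * m + i, j))) [0..<l])"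

definition tprod :: "'a::semiring_0 tensor \<Rightarrow> 'a tensor \<Rightarrow> 'a tensor" (infixl \<open>\<star>\<close> 70) where
  "A \<star> B = tfold (length A) (bcirc A * tunfold B)"

fun ttranspose :: "'a tensor \<Rightarrow> 'a tensor" where
  "ttranspose [] = []"
| "ttranspose (A # As) = transpose_mat A # rev (map transpose_mat As)"

definition tinner :: "'a::semiring_0 tensor \<Rightarrow> 'a tensor \<Rightarrow> 'a" where
  "tinner A B = (\<Sum>k<length A. \<Sum>i<trows A. \<Sum>j<tcols A. (A ! k) $$ (i, j) * (B ! k) $$ (i, j))"

definition tscale :: "'a::times \<Rightarrow> 'a tensor \<Rightarrow> 'a tensor" where
  "tscale c A = map (\<lambda>M. c \<cdot>\<^sub>m M) A"

definition symmetric_tensors :: "nat \<Rightarrow> nat \<Rightarrow> real tensor set" where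
  "symmetric_tensors m l = {A \<in> tensors m m l. ttranspose A = A}"

definition psd_tensors :: "nat \<Rightarrow> nat \<Rightarrow> real tensor set" where
  "psd_tensors m l =
     {A \<in> symmetric_tensors m l. \<forall>X \<in> tensors m 1 l. tinner X (A \<star> X) \<ge> 0}"


section \<open>Polynomials and monomials\<close>

text \<open>The variables \<open>x\<^sub>1, \<dots>, x\<^sub>n\<close> carry the indices \<open>0, \<dots>, n - 1\<close>. Multiplication of polynomials is
  the convolution product of finitely supported functions on exponent vectors, and the coefficient
  of \<open>x\<^sup>\<alpha>\<close> in \<open>p\<close> is \<open>Poly_Mapping.lookup p \<alpha>\<close>.\<close>

type_synonym exponent = "nat \<Rightarrow>\<^sub>0 nat"
type_synonym rpoly = "exponent \<Rightarrow>\<^sub>0 real"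

definition edegree :: "exponent \<Rightarrow> nat" where
  "edegree \<alpha> = (\<Sum>i\<in>Poly_Mapping.keys \<alpha>. Poly_Mapping.lookup \<alpha> i)"

definition exponents_upto :: "nat \<Rightarrow> nat \<Rightarrow> exponent set" where
  "exponents_upto n k = {\<alpha>. Poly_Mapping.keys \<alpha> \<subseteq> {..<n} \<and> edegree \<alpha> \<le> k}"

definition polys :: "nat \<Rightarrow> rpoly set" where
  "polys n = {p. \<forall>\<alpha>\<in>Poly_Mapping.keys p. Poly_Mapping.keys \<alpha> \<subseteq> {..<n}}"

text \<open>The zero polynomial gets degree 0.\<close>

definition total_degree :: "rpoly \<Rightarrow> nat" where
  "total_degree p = Max (insert 0 (edegree ` Poly_Mapping.keys p))"

definition const_poly :: "real \<Rightarrow> rpoly" where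
  "const_poly c = Poly_Mapping.single 0 c"

definition monomial :: "exponent \<Rightarrow> rpoly" where
  "monomial \<alpha> = Poly_Mapping.single \<alpha> 1"

text \<open>The exponents of degree exactly \<open>e\<close> in the given variables, in the order
  \<open>x\<^sub>1\<^sup>e, x\<^sub>1\<^sup>e\<^sup>-\<^sup>1x\<^sub>2, \<dots>, x\<^sub>n\<^sup>e\<close>, i.e. with decreasing powers of the first variable.\<close>

fun homogeneous_exponents :: "nat list \<Rightarrow> nat \<Rightarrow> exponent list" where
  "homogeneous_exponents [] e = (if e = 0 then [0] else [])"
| "homogeneous_exponents (v # vs) e =
     concat (map (\<lambda>a. map (\<lambda>\<alpha>. Poly_Mapping.single v a + \<alpha>) (homogeneous_exponents vs (e - a)))
       (rev [0..<Suc e]))"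

definition exponent_list :: "nat \<Rightarrow> nat \<Rightarrow> exponent list" where
  "exponent_list n k = concat (map (homogeneous_exponents [0..<n]) [0..<Suc k])"

lemma edegree_superset: "finite S \<Longrightarrow> Poly_Mapping.keys \<alpha> \<subseteq> S \<Longrightarrow> edegree \<alpha> = (\<Sum>i\<in>S. Poly_Mapping.lookup \<alpha> i)"
  unfolding edegree_def by (rule sum.mono_neutral_left) (auto simp: in_keys_iff)

lemma edegree_add: "edegree (\<alpha> + \<beta>) = edegree \<alpha> + edegree \<beta>"
proof -
  let ?S = "Poly_Mapping.keys \<alpha> \<union> Poly_Mapping.keys \<beta>"
  have "Poly_Mapping.keys (\<alpha> + \<beta>) \<subseteq> ?S" by (rule Poly_Mapping.keys_add)
  thus ?thesis
    by (simp add: edegree_superset[of ?S] lookup_add sum.distrib)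
qed

lemma edegree_single [simp]: "edegree (Poly_Mapping.single v a) = a"
  by (simp add: edegree_def)

lemma set_homogeneous_exponents:
  "distinct vs \<Longrightarrow> set (homogeneous_exponents vs e) = {\<alpha>. Poly_Mapping.keys \<alpha> \<subseteq> set vs \<and> edegree \<alpha> = e}"
proof (induction vs arbitrary: e)
  case Nil
  then show ?case by (auto simp: edegree_def)
next
  case (Cons v vs)
  show ?case
  proof (intro equalityI subsetI)
    fix \<alpha> assume "\<alpha> \<in> set (homogeneous_exponents (v # vs) e)"
    then obtain a \<beta> where "a \<le> e" "\<beta> \<in> set (homogeneous_exponents vs (e - a))"
      and \<alpha>: "\<alpha> = Poly_Mapping.single v a + \<beta>"
      by (auto simp del: upt_Suc simp: less_Suc_eq_le)
    hence "Poly_Mapping.keys \<beta> \<subseteq> set vs" "edegree \<beta> = e - a" using Cons by auto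
    moreover have "Poly_Mapping.keys \<alpha> \<subseteq> insert v (Poly_Mapping.keys \<beta>)"
      unfolding \<alpha> using Poly_Mapping.keys_add[of "Poly_Mapping.single v a" \<beta>]
      by (auto split: if_splits)
    ultimately show "\<alpha> \<in> {\<alpha>. Poly_Mapping.keys \<alpha> \<subseteq> set (v # vs) \<and> edegree \<alpha> = e}"
      using \<open>a \<le> e\<close> by (auto simp: \<alpha> edegree_add)
  next
    fix \<alpha> assume *: "\<alpha> \<in> {\<alpha>. Poly_Mapping.keys \<alpha> \<subseteq> set (v # vs) \<and> edegree \<alpha> = e}"
    let ?a = "Poly_Mapping.lookup \<alpha> v"
    let ?\<beta> = "Poly_Mapping.update v 0 \<alpha>"
    have eq: "\<alpha> = Poly_Mapping.single v ?a + ?\<beta>"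
      by (rule poly_mapping_eqI) (simp add: lookup_add lookup_update lookup_single when_def)
    have k: "Poly_Mapping.keys ?\<beta> \<subseteq> set vs" using * by (auto simp: keys_update)
    have "e = ?a + edegree ?\<beta>" using * arg_cong[OF eq, of edegree] by (simp add: edegree_add)
    hence "?a \<le> e" "edegree ?\<beta> = e - ?a" by auto
    hence "?\<beta> \<in> set (homogeneous_exponents vs (e - ?a))" using Cons k by auto
    hence "Poly_Mapping.single v ?a + ?\<beta> \<in> set (homogeneous_exponents (v # vs) e)"
      using \<open>?a \<le> e\<close> by (auto simp del: upt_Suc simp: less_Suc_eq_le)
    thus "\<alpha> \<in> set (homogeneous_exponents (v # vs) e)" using eq by simp
  qed
qed

lemma set_exponent_list: "set (exponent_list n k) = exponents_upto n k"
  by (auto simp: exponent_list_def exponents_upto_def set_homogeneous_exponents less_Suc_eq_le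
      atLeast0LessThan simp del: upt_Suc)

lemma finite_exponents_upto: "finite (exponents_upto n k)"
  by (metis List.finite_set set_exponent_list)

lemma length_homogeneous: "length (homogeneous_exponents (v # vs) e) = (length vs + e) choose e"
proof (induction vs arbitrary: v e)
  case Nil
  have "sum_list (map (\<lambda>a. length (homogeneous_exponents [] (e - a))) (rev [0..<Suc e])) = 1"
    by (simp add: sum_list_rev rev_map[symmetric] interv_sum_list_conv_sum_set_nat if_distrib[of length])
  then show ?case by (simp add: length_concat o_def del: upt_Suc)
next
  case (Cons u vs)
  have "length (homogeneous_exponents (v # u # vs) e) = (\<Sum>a=0..<Suc e. (length vs + (e - a)) choose (e - a))"
    by (simp only: homogeneous_exponents.simps(2)[of v] length_concat map_map o_def length_map Cons
         rev_map[symmetric] sum_list_rev interv_sum_list_conv_sum_set_nat set_upt)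
  also have "\<dots> = (\<Sum>a\<le>e. (length vs + a) choose a)"
    by (rule sum.reindex_bij_witness[of _ "\<lambda>a. e - a" "\<lambda>a. e - a"]) auto
  also have "\<dots> = (length (u # vs) + e) choose e" by (simp add: sum_choose_lower)
  finally show ?case .
qed

lemma length_exponent_list: "length (exponent_list n k) = (n + k) choose k"
proof (cases n)
  case 0
  have "length (exponent_list 0 k) = (\<Sum>e=0..<Suc k. if e = 0 then 1 else 0)"
    by (simp only: exponent_list_def length_concat map_map o_def interv_sum_list_conv_sum_set_nat set_upt)
       (rule sum.cong, auto)
  also have "\<dots> = 1" by (subst sum.delta) auto
  finally show ?thesis using 0 by simp
next
  case (Suc n')
  have "[0..<n] = 0 # [1..<n]" using Suc by (simp add: upt_conv_Cons)
  hence "length (exponent_list n k) = (\<Sum>e=0..<Suc k. (n' + e) choose e)"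
    using Suc by (simp only: exponent_list_def length_concat map_map o_def length_homogeneous
         interv_sum_list_conv_sum_set_nat set_upt length_upt) simp
  also have "\<dots> = (\<Sum>e\<le>k. (n' + e) choose e)" by (rule sum.cong) auto
  finally show ?thesis using Suc by (simp add: sum_choose_lower)
qed

lemma distinct_homogeneous: "distinct vs \<Longrightarrow> distinct (homogeneous_exponents vs e)"
proof (induction vs arbitrary: e)
  case Nil then show ?case by simp
next
  case (Cons v vs)
  have lk: "Poly_Mapping.lookup \<beta> v = 0" if "\<beta> \<in> set (homogeneous_exponents vs e')" for \<beta> e'
    using that Cons.prems by (auto simp: set_homogeneous_exponents in_keys_iff)
  have *: "a = a'" if "\<beta> \<in> set (homogeneous_exponents vs (e - a))" "\<beta>' \<in> set (homogeneous_exponents vs (e - a'))"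
     "Poly_Mapping.single v a + \<beta> = Poly_Mapping.single v a' + \<beta>'" for a a' \<beta> \<beta>'
    using arg_cong[OF that(3), of "\<lambda>\<gamma>. Poly_Mapping.lookup \<gamma> v"] lk[OF that(1)] lk[OF that(2)]
    by (simp add: lookup_add)
  have "distinct (concat (map (\<lambda>a. map (\<lambda>\<alpha>. Poly_Mapping.single v a + \<alpha>) (homogeneous_exponents vs (e - a))) as))"
    if "distinct as" for as using that
    using Cons
    by (induction as) (auto simp: distinct_map inj_on_def dest: *)
  then show ?case by (simp del: upt_Suc)
qed

lemma distinct_exponent_list: "distinct (exponent_list n k)"
proof -
  have "distinct (concat (map (homogeneous_exponents [0..<n]) es))" if "distinct es" for es
    using that by (induction es) (auto simp: distinct_homogeneous set_homogeneous_exponents)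
  thus ?thesis by (simp add: exponent_list_def del: upt_Suc)
qed

text \<open>The column vector \<open>[x]\<^sub>k\<close>; its length is \<open>(n + k) choose k\<close>.\<close>

definition monomial_vector :: "nat \<Rightarrow> nat \<Rightarrow> rpoly mat" where
  "monomial_vector n k = (let es = exponent_list n k in
     mat (length es) 1 (\<lambda>(i, j). monomial (es ! i)))"

definition const_tensor :: "real tensor \<Rightarrow> rpoly tensor" where
  "const_tensor Z = map (map_mat const_poly) Z"

text \<open>\<open>poly_tensor m l S A\<close> is the \<open>m \<times> m \<times> l\<close> polynomial tensor
  \<open>\<Sum>\<alpha>\<in>S. A\<^sub>\<alpha> x\<^sup>\<alpha>\<close>.\<close>

definition poly_tensor :: "nat \<Rightarrow> nat \<Rightarrow> exponent set \<Rightarrow> (exponent \<Rightarrow> real tensor) \<Rightarrow> rpoly tensor"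
  where "poly_tensor m l S A =
    map (\<lambda>k. mat m m (\<lambda>(i, j). \<Sum>\<alpha>\<in>S. const_poly ((A \<alpha> ! k) $$ (i, j)) * monomial \<alpha>)) [0..<l]"


section \<open>The T-semidefinite program\<close>

record 'z max_program =
  objective :: "'z \<Rightarrow> real"
  feasible_set :: "'z set"

definition has_feasible_solution :: "'z max_program \<Rightarrow> bool" where
  "has_feasible_solution P \<longleftrightarrow> (\<exists>z. z \<in> feasible_set P)"

text \<open>The decision variable \<open>Z\<close> stands for the tuple \<open>(Z\<^sub>0, \<dots>, Z\<^sub>r)\<close>; its values at indices above
  \<open>r\<close> play no role. The functions \<open>m\<close> and \<open>l\<close> give the sizes of the tensors, and \<open>b \<alpha>\<close> is the
  coefficient of \<open>x\<^sup>\<alpha>\<close> in the objective polynomial.\<close>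

definition tsdp :: "nat \<Rightarrow> nat \<Rightarrow> nat \<Rightarrow> (nat \<Rightarrow> nat) \<Rightarrow> (nat \<Rightarrow> nat) \<Rightarrow> (exponent \<Rightarrow> real) \<Rightarrow>
    (exponent \<Rightarrow> real tensor) \<Rightarrow> (nat \<Rightarrow> exponent \<Rightarrow> real tensor) \<Rightarrow>
    (nat \<Rightarrow> real tensor) max_program" where
  "tsdp n N r m l b A D =
    \<lparr>objective = (\<lambda>Z. - tinner (Z 0) (A 0) - (\<Sum>i=1..r. tinner (Z i) (D i 0))),
     feasible_set = {Z.
       (\<forall>\<alpha> \<in> exponents_upto n (2 * N). 0 < edegree \<alpha> \<longrightarrow>
          tinner (Z 0) (A \<alpha>) + (\<Sum>i=1..r. tinner (Z i) (D i \<alpha>)) = b \<alpha>) \<and>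
       Z 0 \<in> psd_tensors (m 0) (l 0) \<and>
       (\<forall>i\<in>{1..r}. Z i \<in> psd_tensors (m i) (l i))}\<rparr>"

end

theory Submission
  imports Defs
begin

text \<open>Both sides speak of the same tuples of semidefinite tensors, so only the polynomial
  identity has to be matched with the linear constraints. The inner product with a constant tensor
  is linear, so it passes through an expansion in monomials (\<open>tinner_poly_tensor\<close>); the
  factor \<open>g i\<close> is first moved inside (\<open>tinner_tscale\<close>), since
  \<open>D i\<close> expands the scaled product. The right-hand side of the identity thus has
  coefficients c_\<alpha> = <Z_0, A_\<alpha>> + sum_i <Z_i, D_{i\<alpha>}>, for |\<alpha>| \<le> 2N.
  Now compare coefficients with f - \<gamma> (\<open>minus_const_eq_sum_monomials_iff\<close>).
  Exponents \<alpha> \<noteq> 0 give exactly the constraints, and degree at most 2N leaves no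
  coefficient of f outside them. Since f has no constant term, \<alpha> = 0 only says \<gamma> =
  -c_0, which a free \<gamma> can always satisfy.\<close>

lemma tinner_tensors:
  assumes "Z \<in> tensors m n l"
  shows "tinner Z B = (\<Sum>k<l. \<Sum>i<m. \<Sum>j<n. (Z ! k) $$ (i, j) * (B ! k) $$ (i, j))"
proof (cases Z)
  \<comment> \<open>\<open>trows\<close> and \<open>tcols\<close> of the empty list are unspecified,
    but here \<open>l = 0\<close> and both sums over slices are empty.\<close>
  case Nil
  then show ?thesis using assms by (simp add: tinner_def tensors_def)
next
  case (Cons M Ms)
  then show ?thesis using assms by (auto simp: tinner_def tensors_def trows_def tcols_def)
qed

lemma const_tensor_tensors: "Z \<in> tensors m n l \<Longrightarrow> const_tensor Z \<in> tensors m n l"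
  by (auto simp: tensors_def const_tensor_def)

lemma const_tensor_index:
  assumes "Z \<in> tensors m n l" "k < l" "i < m" "j < n"
  shows "(const_tensor Z ! k) $$ (i, j) = const_poly ((Z ! k) $$ (i, j))"
proof -
  have "Z ! k \<in> carrier_mat m n"
    using assms by (auto simp: tensors_def)
  then show ?thesis
    using assms by (simp add: tensors_def const_tensor_def)
qed

lemma const_poly_add: "const_poly (a + b) = const_poly a + const_poly b"
  by (simp add: const_poly_def single_add)

lemma const_poly_sum: "const_poly (sum h S) = (\<Sum>x\<in>S. const_poly (h x))"
  by (induction S rule: infinite_finite_induct) (simp_all add: const_poly_add, simp_all add: const_poly_def)

lemma const_poly_mult: "const_poly (a * b) = const_poly a * const_poly b"
  by (simp add: const_poly_def mult_single)

lemma const_poly_times_monomial: "const_poly c * monomial \<alpha> = Poly_Mapping.single \<alpha> c"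
  by (simp add: const_poly_def monomial_def mult_single)

text \<open>Distinct monomials are linearly independent, so the coefficients of such a sum can be
  read off.\<close>

lemma lookup_sum_monomials:
  assumes "finite S"
  shows "Poly_Mapping.lookup (\<Sum>\<alpha>\<in>S. const_poly (c \<alpha>) * monomial \<alpha>) \<beta> = (if \<beta> \<in> S then c \<beta> else 0)"
  using assms by (simp add: const_poly_times_monomial lookup_sum lookup_single when_def)

text \<open>Linearity in the second argument, combined with \<open>const_poly\<close> being a ring
  homomorphism: the real inner products may be formed before or after embedding into
  polynomials.\<close>

lemma tinner_poly_tensor:
  assumes Z: "Z \<in> tensors m m l"
  shows "tinner (const_tensor Z) (poly_tensor m l S A) =
    (\<Sum>\<alpha>\<in>S. const_poly (tinner Z (A \<alpha>)) * monomial \<alpha>)"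
proof -
  have "tinner (const_tensor Z) (poly_tensor m l S A) =
      (\<Sum>k<l. \<Sum>i<m. \<Sum>j<m. \<Sum>\<alpha>\<in>S.
        const_poly ((Z ! k) $$ (i, j) * (A \<alpha> ! k) $$ (i, j)) * monomial \<alpha>)"
    using Z by (simp add: tinner_tensors[OF const_tensor_tensors[OF Z]] const_tensor_index
        poly_tensor_def sum_distrib_left const_poly_mult mult.assoc)
  also have "\<dots> = (\<Sum>\<alpha>\<in>S. \<Sum>k<l. \<Sum>i<m. \<Sum>j<m.
        const_poly ((Z ! k) $$ (i, j) * (A \<alpha> ! k) $$ (i, j)) * monomial \<alpha>)"
    \<comment> \<open>Fixing \<open>S\<close> as the inner index set orients the swap, so rewriting
      moves that sum outwards past the other three.\<close>
    by (simp add: sum.swap[of _ S])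
  finally show ?thesis
    by (simp add: tinner_tensors[OF Z] const_poly_sum sum_distrib_right)
qed

lemma poly_tensor_tensors: "poly_tensor m l S A \<in> tensors m m l"
  by (auto simp: poly_tensor_def tensors_def)

text \<open>The shape is assumed for \<open>tscale p T\<close> because that is where it is known: in
  the application the scaled tensor equals a \<open>poly_tensor\<close>, which spares computing the
  shape of the product \<open>T\<close>.\<close>

lemma tinner_tscale:
  fixes p :: rpoly
  assumes Z: "Z \<in> tensors m n l" and T: "tscale p T \<in> tensors m n l"
  shows "tinner Z (tscale p T) = p * tinner Z T"
proof -
  have "(tscale p T ! k) $$ (i, j) = p * (T ! k) $$ (i, j)" if "k < l" "i < m" "j < n" for k i j
  proof -
    have k: "k < length T" using T that by (simp add: tensors_def tscale_def)
    then have "p \<cdot>\<^sub>m T ! k \<in> carrier_mat m n"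
      using T by (auto simp: tensors_def tscale_def)
    \<comment> \<open>Scaling preserves dimensions, so those of the scaled slice carry back to
      \<open>T ! k\<close>.\<close>
    then have "T ! k \<in> carrier_mat m n" by (metis carrier_matD carrier_matI index_smult_mat(2,3))
    then show ?thesis using that k by (simp add: tscale_def)
  qed
  then show ?thesis
    by (simp add: tinner_tensors[OF Z] sum_distrib_left mult.left_commute)
qed

text \<open>The degree condition on the constraints excludes the constant term and nothing
  else.\<close>

lemma edegree_pos_iff: "0 < edegree \<alpha> \<longleftrightarrow> \<alpha> \<noteq> 0"
proof
  show "\<alpha> \<noteq> 0" if "0 < edegree \<alpha>" using that by (auto simp: edegree_def)
  show "0 < edegree \<alpha>" if nz: "\<alpha> \<noteq> 0"
  proof -
    obtain i where "i \<in> Poly_Mapping.keys \<alpha>" using nz by (metis all_not_in_conv keys_eq_empty)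
    then show ?thesis by (auto simp: edegree_def in_keys_iff intro!: sum_pos2[of _ i])
  qed
qed

text \<open>Applied to \<open>f\<close> with \<open>k = 2 * N\<close>: no coefficient of
  \<open>f\<close> escapes the constraints.\<close>

lemma lookup_outside_exponents_upto:
  assumes "p \<in> polys n" "total_degree p \<le> k" "\<alpha> \<notin> exponents_upto n k"
  shows "Poly_Mapping.lookup p \<alpha> = 0"
proof (rule ccontr)
  assume "Poly_Mapping.lookup p \<alpha> \<noteq> 0"
  then have key: "\<alpha> \<in> Poly_Mapping.keys p" by (simp add: in_keys_iff)
  then have "edegree \<alpha> \<le> total_degree p"
    unfolding total_degree_def by (intro Max_ge) auto
  with key assms show False by (auto simp: polys_def exponents_upto_def)
qed

text \<open>Evaluating at the exponent \<open>0\<close> fixes \<open>\<gamma>\<close>; every other exponent gives one of the linear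
  constraints of the program.\<close>

lemma minus_const_eq_sum_monomials_iff:
  assumes "p \<in> polys n" "total_degree p \<le> k" "Poly_Mapping.lookup p 0 = 0"
  shows "p - const_poly \<gamma> = (\<Sum>\<alpha>\<in>exponents_upto n k. const_poly (c \<alpha>) * monomial \<alpha>) \<longleftrightarrow>
    \<gamma> = - c 0 \<and> (\<forall>\<alpha>\<in>exponents_upto n k. 0 < edegree \<alpha> \<longrightarrow> c \<alpha> = Poly_Mapping.lookup p \<alpha>)"
    (is "?L \<longleftrightarrow> ?R")
proof -
  have zero: "0 \<in> exponents_upto n k" by (simp add: exponents_upto_def edegree_def)
  have "?L \<longleftrightarrow> (\<forall>\<alpha>. Poly_Mapping.lookup p \<alpha> - (if \<alpha> = 0 then \<gamma> else 0) =
      (if \<alpha> \<in> exponents_upto n k then c \<alpha> else 0))"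
    by (auto simp: poly_mapping_eq_iff fun_eq_iff lookup_minus const_poly_def lookup_single when_def
        lookup_sum_monomials[OF finite_exponents_upto, unfolded const_poly_def])
  also have "\<dots> \<longleftrightarrow> ?R" (is "?M \<longleftrightarrow> _")
  proof
    assume M: ?M
    then have "\<gamma> = - c 0" using zero assms(3) spec[OF M, of 0] by simp
    moreover have "c \<alpha> = Poly_Mapping.lookup p \<alpha>" if "\<alpha> \<in> exponents_upto n k" "0 < edegree \<alpha>" for \<alpha>
      using spec[OF M, of \<alpha>] that by (simp add: edegree_pos_iff)
    ultimately show ?R by blast
  next
    assume ?R
    \<comment> \<open>The exponent 0 is settled by \<gamma>, the other exponents of the set by the
      constraints; outside the set both sides vanish by the degree bound.\<close>
    then show ?M
      using zero assms(3) lookup_outside_exponents_upto[OF assms(1,2)] by (auto simp: edegree_pos_iff)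
  qed
  finally show ?thesis .
qed

theorem theorem4:
  fixes n r N d :: nat
    and f :: rpoly and g :: "nat \<Rightarrow> rpoly"
    and w wt m l :: "nat \<Rightarrow> nat"
    and X :: "nat \<Rightarrow> rpoly tensor"
    and A :: "exponent \<Rightarrow> real tensor" and D :: "nat \<Rightarrow> exponent \<Rightarrow> real tensor"
  assumes f: "f \<in> polys n" "total_degree f = d" "Poly_Mapping.lookup f 0 = 0"
    and g: "\<forall>i\<in>{1..r}. g i \<in> polys n \<and> total_degree (g i) = w i"
    and wt: "\<forall>i\<in>{1..r}. wt i = nat \<lceil>real (w i) / 2\<rceil>"
    and N: "0 < N" "d \<le> 2 * N" "\<forall>i\<in>{1..r}. w i \<le> 2 * N"
    and pos: "\<forall>i\<in>{0..r}. 0 < m i \<and> 0 < l i"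
    and size0: "(n + N) choose N = m 0 * l 0"
    and size: "\<forall>i\<in>{1..r}. (n + (N - wt i)) choose (N - wt i) = m i * l i"
    and X0: "X 0 = tfold (l 0) (monomial_vector n N)"
    and X: "\<forall>i\<in>{1..r}. X i = tfold (l i) (monomial_vector n (N - wt i))"
    and A_dim: "\<forall>\<alpha>\<in>exponents_upto n (2 * N). A \<alpha> \<in> tensors (m 0) (m 0) (l 0)"
    and A: "X 0 \<star> ttranspose (X 0) = poly_tensor (m 0) (l 0) (exponents_upto n (2 * N)) A"
    and D_dim: "\<forall>i\<in>{1..r}. \<forall>\<alpha>\<in>exponents_upto n (2 * N). D i \<alpha> \<in> tensors (m i) (m i) (l i)"
    and D: "\<forall>i\<in>{1..r}. tscale (g i) (X i \<star> ttranspose (X i)) =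
              poly_tensor (m i) (l i) (exponents_upto n (2 * N)) (D i)"
  shows "has_feasible_solution (tsdp n N r m l (Poly_Mapping.lookup f) A D) \<longleftrightarrow>
    (\<exists>(\<gamma>::real) (Z :: nat \<Rightarrow> real tensor).
       Z 0 \<in> psd_tensors (m 0) (l 0) \<and>
       (\<forall>i\<in>{1..r}. Z i \<in> psd_tensors (m i) (l i)) \<and>
       f - const_poly \<gamma> =
         tinner (const_tensor (Z 0)) (X 0 \<star> ttranspose (X 0)) +
         (\<Sum>i=1..r. g i * tinner (const_tensor (Z i)) (X i \<star> ttranspose (X i))))"
proof -
  let ?S = "exponents_upto n (2 * N)"
  let ?feas = "\<lambda>Z. Z 0 \<in> psd_tensors (m 0) (l 0) \<and> (\<forall>i\<in>{1..r}. Z i \<in> psd_tensors (m i) (l i))"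
  let ?c = "\<lambda>Z \<alpha>. tinner (Z 0) (A \<alpha>) + (\<Sum>i=1..r. tinner (Z i) (D i \<alpha>))"
  let ?rhs = "\<lambda>Z. tinner (const_tensor (Z 0)) (X 0 \<star> ttranspose (X 0)) +
         (\<Sum>i=1..r. g i * tinner (const_tensor (Z i)) (X i \<star> ttranspose (X i)))"
  have psd: "Y \<in> tensors m' m' l'" if "Y \<in> psd_tensors m' l'" for Y m' l'
    using that by (simp add: psd_tensors_def symmetric_tensors_def)
  \<comment> \<open>The coefficient of each monomial in the certificate is the left-hand side
    \<open>?c Z \<alpha>\<close> of the constraint for that exponent.\<close>
  have rhs: "?rhs Z = (\<Sum>\<alpha>\<in>?S. const_poly (?c Z \<alpha>) * monomial \<alpha>)" if Z: "?feas Z" for Z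
  proof -
    have "g i * tinner (const_tensor (Z i)) (X i \<star> ttranspose (X i)) =
        (\<Sum>\<alpha>\<in>?S. const_poly (tinner (Z i) (D i \<alpha>)) * monomial \<alpha>)" if i: "i \<in> {1..r}" for i
    proof -
      have Zi: "Z i \<in> tensors (m i) (m i) (l i)" using Z i psd by blast
      have Di: "tscale (g i) (X i \<star> ttranspose (X i)) = poly_tensor (m i) (l i) ?S (D i)"
        using D i by blast
      show ?thesis
        using tinner_tscale[OF const_tensor_tensors[OF Zi], of "g i" "X i \<star> ttranspose (X i)"]
        by (simp add: Di poly_tensor_tensors tinner_poly_tensor[OF Zi])
    qed
    moreover have "tinner (const_tensor (Z 0)) (X 0 \<star> ttranspose (X 0)) =
        (\<Sum>\<alpha>\<in>?S. const_poly (tinner (Z 0) (A \<alpha>)) * monomial \<alpha>)"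
      using Z psd by (simp add: A tinner_poly_tensor)
    ultimately have "?rhs Z = (\<Sum>\<alpha>\<in>?S. const_poly (tinner (Z 0) (A \<alpha>)) * monomial \<alpha>) +
        (\<Sum>i=1..r. \<Sum>\<alpha>\<in>?S. const_poly (tinner (Z i) (D i \<alpha>)) * monomial \<alpha>)"
      by simp
    also have "\<dots> = (\<Sum>\<alpha>\<in>?S. const_poly (?c Z \<alpha>) * monomial \<alpha>)"
      by (subst sum.swap) (simp add: const_poly_add const_poly_sum distrib_right sum_distrib_right sum.distrib)
    finally show ?thesis .
  qed
  \<comment> \<open>Here \<gamma> is forced to be \<open>- ?c Z 0\<close>, the objective value at
    \<open>Z\<close>; the bound \<open>d \<le> 2 * N\<close> enters at this point.\<close>
  have "f - const_poly \<gamma> = ?rhs Z \<longleftrightarrow> \<gamma> = - ?c Z 0 \<and>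
      (\<forall>\<alpha>\<in>?S. 0 < edegree \<alpha> \<longrightarrow> ?c Z \<alpha> = Poly_Mapping.lookup f \<alpha>)" if "?feas Z" for \<gamma> Z
    unfolding rhs[OF that] using f N(2) by (intro minus_const_eq_sum_monomials_iff) auto
  \<comment> \<open>The equation for \<gamma> is always solvable, so the quantifier over \<gamma>
    disappears.\<close>
  then have "(\<exists>\<gamma> Z. ?feas Z \<and> f - const_poly \<gamma> = ?rhs Z) \<longleftrightarrow>
      (\<exists>Z. ?feas Z \<and> (\<forall>\<alpha>\<in>?S. 0 < edegree \<alpha> \<longrightarrow> ?c Z \<alpha> = Poly_Mapping.lookup f \<alpha>))"
    by blast
  then show ?thesis
    by (auto simp: has_feasible_solution_def tsdp_def)
qed

end
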